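(* Let $\mathcal{P}^+\subset\mathrm{Sym}^2(\mathbb{R}^n)$ be a closed convex cone (with vertex at the origin) satisfying the Positivity Condition, and let $M$ be a closed submanifold of an open set $X\subset\mathbb{R}^n$. Then $M$ is $\mathcal{P}_+$-free if and only if the square of the distance to $M$ is strictly $\mathcal{P}^+$-plurisubharmonic at each point of $M$ (and hence in a neighborhood of $M$ in $X$).
   Context: $\mathrm{Sym}^2(\mathbb{R}^n)$ is the space of quadratic forms on $\mathbb{R}^n$ (real symmetric $n\times n$ matrices) with inner product $\langle A,B\rangle=\mathrm{tr}(AB)$, and $\mathcal{P}=\{A:A\ge0\}$. The polar of $\mathcal{P}^+$ is $\mathcal{P}_+=\{A:\langle A,B\rangle\ge0\ \forall B\in\mathcal{P}^+\}$. Positivity Condition: every $A\in\mathcal{P}_+$ is $\ge0$, equivalently $\mathcal{P}\subset\mathcal{P}^+$. For a linear subspace $W\subset\mathbb{R}^n$, $\mathrm{Sym}^2(W)$ is regarded as the subspace of $\mathrm{Sym}^2(\mathbb{R}^n)$ of those $A$ vanishing on $W^\perp$. A linear subspace $W\subset\mathbb{R}^n$ is $\mathcal{P}_+$-free if $\mathcal{P}_+\cap\mathrm{Sym}^2(W)=\{0\}$. A closed (smooth, embedded) submanifold $M\subset X$ is $\mathcal{P}_+$-free if $T_xM$ is $\mathcal{P}_+$-free for each $x\in M$. The function $\mathrm{dist}(\cdot,M)^2$ is smooth near $M$. A function $f$, smooth near $x$, is strictly $\mathcal{P}^+$-plurisubharmonic at $x$ if $\mathrm{Hess}_xf\in\mathrm{Int}\,\mathcal{P}^+$.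 *)

theory Defs
  imports "HOL-Analysis.Analysis"
begin

section \<open>Smooth functions on open sets\<close>

text \<open>Meant for open \<open>S\<close> only. In finite dimension, \<open>Ck_on k\<close> is class $C^k$: a
  differentiable map all of whose directional derivatives are $C^k$ is $C^{k+1}$.\<close>

primrec Ck_on :: "nat \<Rightarrow> ('a::real_normed_vector \<Rightarrow> 'b::real_normed_vector) \<Rightarrow> 'a set \<Rightarrow> bool" where
  "Ck_on 0 f S \<longleftrightarrow> continuous_on S f"
| "Ck_on (Suc k) f S \<longleftrightarrow>
     (\<forall>x\<in>S. f differentiable (at x)) \<and>
     (\<forall>v. Ck_on k (\<lambda>x. frechet_derivative f (at x) v) S)"

definition smooth_on :: "('a::real_normed_vector \<Rightarrow> 'b::real_normed_vector) \<Rightarrow> 'a set \<Rightarrow> bool" where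
  "smooth_on f S \<longleftrightarrow> (\<forall>k. Ck_on k f S)"

definition smooth_near :: "('a::real_normed_vector \<Rightarrow> 'b::real_normed_vector) \<Rightarrow> 'a \<Rightarrow> bool" where
  "smooth_near f x \<longleftrightarrow> (\<exists>U. open U \<and> x \<in> U \<and> smooth_on f U)"

definition hessian :: "(real^'n \<Rightarrow> real) \<Rightarrow> real^'n \<Rightarrow> real^'n^'n" where
  "hessian f x =
     (\<chi> i j. frechet_derivative (\<lambda>y. frechet_derivative f (at y) (axis j 1)) (at x) (axis i 1))"


section \<open>Submanifolds of Euclidean space\<close>

text \<open>Smooth embedded submanifolds of the open set \<open>X\<close> that are closed subsets of \<open>X\<close> (not
  necessarily of the ambient space), described by slice charts. The model subspace \<open>L\<close> may depend
  on the point, so different components may have different dimensions.\<close>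

definition closed_submanifold :: "(real^'n) set \<Rightarrow> (real^'n) set \<Rightarrow> bool" where
  "closed_submanifold X M \<longleftrightarrow>
     closedin (top_of_set X) M \<and>
     (\<forall>x\<in>M. \<exists>U V \<phi> \<psi> (L :: (real^'n) set).
        open U \<and> x \<in> U \<and> U \<subseteq> X \<and> open V \<and>
        homeomorphism U V \<phi> \<psi> \<and> smooth_on \<phi> U \<and> smooth_on \<psi> V \<and>
        subspace L \<and> \<phi> ` (M \<inter> U) = L \<inter> V)"

text \<open>Velocities at \<open>x\<close> of the smooth curves in \<open>M\<close> through \<open>x\<close>.\<close>

definition tangent_space :: "(real^'n) set \<Rightarrow> real^'n \<Rightarrow> (real^'n) set" where
  "tangent_space M x =
     {v. \<exists>\<gamma> e. e > 0 \<and> smooth_on \<gamma> {-e<..<e} \<and> \<gamma> ` {-e<..<e} \<subseteq> M \<and> \<gamma> 0 = x \<and>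
           (\<gamma> has_vector_derivative v) (at (0::real))}"


section \<open>Quadratic forms\<close>

definition Sym2 :: "(real^'n^'n) set" where
  "Sym2 = {A. transpose A = A}"

definition psd :: "(real^'n^'n) set" where
  "psd = {A \<in> Sym2. \<forall>v. 0 \<le> v \<bullet> (A *v v)}"

definition polar :: "(real^'n^'n) set \<Rightarrow> (real^'n^'n) set" where
  "polar P = {A \<in> Sym2. \<forall>B\<in>P. 0 \<le> trace (A ** B)}"

definition positivity_condition :: "(real^'n^'n) set \<Rightarrow> bool" where
  "positivity_condition P \<longleftrightarrow> polar P \<subseteq> psd"

text \<open>\<open>A\<close> vanishes on $W^\perp$ as a linear map, i.e. $A(v,w) = 0$ for all $v \in W^\perp$ and
  \<^emph>\<open>all\<close> $w$; it is not enough that the quadratic form of \<open>A\<close> restricts to zero on $W^\perp$.\<close>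

definition Sym2_on :: "(real^'n) set \<Rightarrow> (real^'n^'n) set" where
  "Sym2_on W = {A \<in> Sym2. \<forall>v \<in> orthogonal_comp W. A *v v = 0}"


section \<open>Free submanifolds and strict plurisubharmonicity\<close>

text \<open>In the following definitions \<open>P\<close> is the cone $\mathcal P^+$, and \<open>polar P\<close> is
  $\mathcal P_+$.\<close>

definition free_subspace :: "(real^'n^'n) set \<Rightarrow> (real^'n) set \<Rightarrow> bool" where
  "free_subspace P W \<longleftrightarrow> subspace W \<and> polar P \<inter> Sym2_on W = {0}"

definition free_submanifold :: "(real^'n^'n) set \<Rightarrow> (real^'n) set \<Rightarrow> bool" where
  "free_submanifold P M \<longleftrightarrow> (\<forall>x\<in>M. free_subspace P (tangent_space M x))"

text \<open>The interior is the one relative to \<open>Sym2\<close>; the interior in the space of all matrices is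
  empty as soon as \<open>Sym2\<close> is a proper subspace.\<close>

definition strictly_psh_at :: "(real^'n^'n) set \<Rightarrow> (real^'n \<Rightarrow> real) \<Rightarrow> real^'n \<Rightarrow> bool" where
  "strictly_psh_at P f x \<longleftrightarrow>
     smooth_near f x \<and> hessian f x \<in> (top_of_set Sym2) interior_of P"

end

theory Submission
  imports Defs
begin

text \<open>
  Fix \<open>x \<in> M\<close> and let \<open>T\<close> be the tangent space of \<open>M\<close> at \<open>x\<close>. Near \<open>x\<close> the distance to \<open>M\<close> is
  the norm of a smooth map \<open>g\<close>, namely \<open>g y = y - \<pi> y\<close> with \<open>\<pi>\<close> the nearest point map. Since
  \<open>g x = 0\<close>, all terms with second derivatives of \<open>g\<close> drop out of the Hessian of
  \<open>\<bar>g\<bar>\<^sup>2\<close> at \<open>x\<close>, which is therefore twice the Gram matrix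
  \<open>G\<^sup>t G\<close> of the Jacobian \<open>G\<close> of \<open>g\<close> at \<open>x\<close>, and the kernel of \<open>G\<close> is exactly \<open>T\<close>
  (\<open>distance_is_norm_of_smooth_map\<close>, \<open>hessian_norm_square\<close>).

  Write \<open>\<langle>A, B\<rangle>\<close> for the trace of \<open>A B\<close>. By the bipolar theorem and the compactness of the
  unit sphere, a symmetric \<open>B\<close> is interior to the closed convex cone \<open>P\<close> if and only if
  \<open>\<langle>A, B\<rangle> > 0\<close> for all nonzero \<open>A\<close> in the polar of \<open>P\<close>
  (\<open>interior_iff_positive_on_polar\<close>). For \<open>B = G\<^sup>t G\<close> the number \<open>\<langle>A, B\<rangle>\<close> is the sum of the
  values of the quadratic form \<open>A\<close> on the rows of \<open>G\<close>. The positivity condition makes every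
  polar \<open>A\<close> positive semidefinite, so these values are nonnegative, and they all vanish if and
  only if \<open>A\<close> annihilates the span of the rows. That span is the orthogonal complement of \<open>T\<close>, so
  the vanishing says that \<open>A\<close> lies in the space of forms on \<open>T\<close>. Hence the Hessian is interior
  to \<open>P\<close> precisely when no nonzero polar form lives on \<open>T\<close> (\<open>free_iff_gram_interior\<close>).

  For the map \<open>g\<close>, straighten \<open>M\<close> to a linear subspace \<open>L\<close> by a chart \<open>\<phi>\<close> with inverse \<open>\<psi>\<close>. The
  transpose of the derivative of \<open>\<phi>\<close> carries the complement of \<open>L\<close> to the normal space of \<open>M\<close>,
  which gives a smooth map \<open>E\<close>, defined near a point of \<open>L\<close>, that parametrizes a tubular
  neighbourhood of a piece of \<open>M\<close>. The inverse function theorem inverts \<open>E\<close>, and since a nearest point of \<open>M\<close> is reached along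
  a normal vector, the inverse of \<open>E\<close> reads off the nearest point. The same description of \<open>T\<close> as
  a kernel shows that \<open>T\<close> is a subspace.

  Finally, strict plurisubharmonicity is an open condition: the Hessian of a smooth function is
  continuous, and it stays symmetric by Schwarz's theorem, so it remains in the relative
  interior of \<open>P\<close> at nearby points (\<open>strictly_psh_at_open_nhd\<close>).
\<close>


section \<open>Calculus of $C^k$ maps\<close>

lemma Ck_on_cong:
  assumes "open S" and "\<And>x. x \<in> S \<Longrightarrow> f x = g x"
  shows "Ck_on k f S \<longleftrightarrow> Ck_on k g S"
  using assms(2)
proof (induction k arbitrary: f g)
  case 0
  then show ?case by (simp cong: continuous_on_cong)
next
  case (Suc k)
  have "f differentiable (at x) \<longleftrightarrow> g differentiable (at x)" if "x \<in> S" for x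
    unfolding differentiable_def
    using has_derivative_transform_within_open[OF _ assms(1) that] Suc.prems by metis
  moreover have "frechet_derivative f (at x) v = frechet_derivative g (at x) v"
    if "x \<in> S" "f differentiable (at x)" for x v
    using frechet_derivative_transform_within_open[OF that(2) assms(1) that(1)] Suc.prems by metis
  ultimately show ?case
    unfolding Ck_on.simps using Suc.IH by (metis (no_types, lifting))
qed

lemma Ck_on_subset: "Ck_on k f S \<Longrightarrow> T \<subseteq> S \<Longrightarrow> Ck_on k f T"
  by (induction k arbitrary: f) (auto intro: continuous_on_subset)

lemma Ck_on_SucD: "Ck_on (Suc k) f S \<Longrightarrow> Ck_on k f S"
proof (induction k arbitrary: f)
  case 0
  then show ?case
    by (auto simp: intro!: continuous_at_imp_continuous_on differentiable_imp_continuous_within)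
next
  case (Suc k)
  then show ?case using Ck_on.simps(2) by blast
qed

lemma Ck_on_has_derivative:
  "Ck_on (Suc k) f S \<Longrightarrow> x \<in> S \<Longrightarrow> (f has_derivative frechet_derivative f (at x)) (at x)"
  using frechet_derivative_works by auto

text \<open>The closure properties below are proved by induction on \<open>k\<close> with this rule: it lets the
  derivative be any formula that is correct on \<open>S\<close>, so that the remaining task is to recognise that
  formula as built from $C^k$ maps.\<close>

lemma Ck_on_SucI:
  assumes "open S" and der: "\<And>x. x \<in> S \<Longrightarrow> (f has_derivative f' x) (at x)"
    and "\<And>v. Ck_on k (\<lambda>x. f' x v) S"
  shows "Ck_on (Suc k) f S"
proof -
  have "frechet_derivative f (at x) v = f' x v" if "x \<in> S" for x v
    using frechet_derivative_at[OF der[OF that]] by simp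
  then have "Ck_on k (\<lambda>x. frechet_derivative f (at x) v) S" for v
    using assms(3)[of v] Ck_on_cong[OF assms(1), of "\<lambda>x. frechet_derivative f (at x) v" "\<lambda>x. f' x v" k]
    by auto
  then show ?thesis using der by (auto simp: differentiable_def)
qed

lemma Ck_on_const: "Ck_on k (\<lambda>x. c) S"
  by (induction k arbitrary: c) auto

lemma Ck_on_bounded_linear:
  assumes "bounded_linear h" "open S"
  shows "Ck_on k h S"
proof (cases k)
  case 0
  then show ?thesis using assms by (simp add: linear_continuous_on)
next
  case (Suc m)
  show ?thesis unfolding Suc
    by (rule Ck_on_SucI[where f' = "\<lambda>x. h"])
       (use assms bounded_linear_imp_has_derivative in \<open>auto intro: Ck_on_const\<close>)
qed

lemma Ck_on_linear_comp:
  assumes "bounded_linear h" "open S" "Ck_on k f S"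
  shows "Ck_on k (\<lambda>x. h (f x)) S"
  using assms(3)
proof (induction k arbitrary: f)
  case 0
  then show ?case using assms(1) by (simp add: bounded_linear.continuous_on)
next
  case (Suc k)
  show ?case
  proof (rule Ck_on_SucI[OF assms(2)])
    show "((\<lambda>x. h (f x)) has_derivative (\<lambda>v. h (frechet_derivative f (at x) v))) (at x)"
      if "x \<in> S" for x
      using bounded_linear.has_derivative[OF assms(1)] Ck_on_has_derivative[OF Suc.prems that] .
    show "Ck_on k (\<lambda>x. h (frechet_derivative f (at x) v)) S" for v
      using Suc by simp
  qed
qed

lemma Ck_on_add:
  assumes "open S" "Ck_on k f S" "Ck_on k g S"
  shows "Ck_on k (\<lambda>x. f x + g x) S"
  using assms(2,3)
proof (induction k arbitrary: f g)
  case 0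
  then show ?case by (simp add: continuous_on_add)
next
  case (Suc k)
  show ?case
    by (rule Ck_on_SucI[OF assms(1) has_derivative_add[OF Ck_on_has_derivative[OF Suc.prems(1)]
          Ck_on_has_derivative[OF Suc.prems(2)]]]) (use Suc in auto)
qed

lemma Ck_on_sum:
  assumes "open S" "\<And>i. i \<in> I \<Longrightarrow> Ck_on k (f i) S"
  shows "Ck_on k (\<lambda>x. \<Sum>i\<in>I. f i x) S"
  using assms(2)
  by (induction I rule: infinite_finite_induct) (auto intro: Ck_on_const Ck_on_add[OF assms(1)])

lemma Ck_on_bilinear:
  assumes "bounded_bilinear bil" "open S" "Ck_on k f S" "Ck_on k g S"
  shows "Ck_on k (\<lambda>x. bil (f x) (g x)) S"
  using assms(3,4)
proof (induction k arbitrary: f g)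
  case 0
  then show ?case using assms(1) by (simp add: bounded_bilinear.continuous_on)
next
  case (Suc k)
  show ?case
  proof (rule Ck_on_SucI[OF assms(2) bounded_bilinear.FDERIV[OF assms(1)
          Ck_on_has_derivative[OF Suc.prems(1)] Ck_on_has_derivative[OF Suc.prems(2)]]])
    fix v
    show "Ck_on k (\<lambda>x. bil (f x) (frechet_derivative g (at x) v) +
        bil (frechet_derivative f (at x) v) (g x)) S"
      using Suc.prems Suc.prems[THEN Ck_on_SucD] by (intro Ck_on_add Suc.IH assms(2)) simp_all
  qed
qed

lemma Ck_on_prod:
  fixes f :: "'i \<Rightarrow> 'a::real_normed_vector \<Rightarrow> real"
  assumes "open S" "\<And>i. i \<in> I \<Longrightarrow> Ck_on k (f i) S"
  shows "Ck_on k (\<lambda>x. \<Prod>i\<in>I. f i x) S"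
  using assms(2)
  by (induction I rule: infinite_finite_induct)
     (auto intro: Ck_on_const Ck_on_bilinear[OF bounded_bilinear_mult assms(1)])

lemma Ck_on_inverse:
  fixes f :: "'a::real_normed_vector \<Rightarrow> real"
  assumes "open S" "Ck_on k f S" "\<And>x. x \<in> S \<Longrightarrow> f x \<noteq> 0"
  shows "Ck_on k (\<lambda>x. inverse (f x)) S"
  using assms(2)
proof (induction k)
  case 0
  then show ?case using assms(3) by (simp add: continuous_on_inverse)
next
  case (Suc k)
  note mult = Ck_on_bilinear[OF bounded_bilinear_mult assms(1)]
  have IH: "Ck_on k (\<lambda>x. inverse (f x)) S"
    using Suc Ck_on_SucD by blast
  show ?case
  proof (rule Ck_on_SucI[OF assms(1) Deriv.has_derivative_inverse[OF assms(3)
          Ck_on_has_derivative[OF Suc.prems]]])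
    fix v
    have "Ck_on k (\<lambda>x. frechet_derivative f (at x) v) S" using Suc.prems by simp
    then have "Ck_on k (\<lambda>x. inverse (f x) * frechet_derivative f (at x) v * inverse (f x)) S"
      by (intro mult IH)
    then show "Ck_on k (\<lambda>x. - (inverse (f x) * frechet_derivative f (at x) v * inverse (f x))) S"
      by (rule Ck_on_linear_comp[OF bounded_linear_minus[OF bounded_linear_ident] assms(1)])
  qed 
qed

lemma bounded_linear_Basis_expansion:
  fixes h :: "'a::euclidean_space \<Rightarrow> 'b::real_normed_vector"
  assumes "bounded_linear h"
  shows "h x = (\<Sum>b\<in>Basis. (x \<bullet> b) *\<^sub>R h b)"
proof -
  interpret bounded_linear h by fact
  show ?thesis
    by (subst (1) euclidean_representation[of x, symmetric]) (simp add: sum scaleR)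
qed

text \<open>The chain rule gives the derivative of \<open>g \<circ> f\<close> along \<open>v\<close> as the derivative of \<open>g\<close>
  along a direction that varies with the point. \<open>Ck_on\<close> only controls derivatives along fixed
  directions, so the varying one is expanded in the basis of the intermediate space; this is why
  that space is Euclidean.\<close>

lemma Ck_on_compose:
  fixes f :: "'a::real_normed_vector \<Rightarrow> 'b::euclidean_space"
    and g :: "'b \<Rightarrow> 'c::real_normed_vector"
  assumes "open S" "open T" "Ck_on k f S" "Ck_on k g T" "f ` S \<subseteq> T"
  shows "Ck_on k (\<lambda>x. g (f x)) S"
  using assms(3,4)
proof (induction k arbitrary: g)
  case 0
  then show ?case using continuous_on_compose2[of T g S f] assms(5) by simp
next
  case (Suc k)
  let ?F = "\<lambda>x. frechet_derivative f (at x)"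
  let ?G = "\<lambda>y. frechet_derivative g (at y)"
  have f: "Ck_on k f S" using Suc.prems Ck_on_SucD by blast
  show ?case
  proof (rule Ck_on_SucI[OF assms(1)])
    fix x assume x: "x \<in> S"
    have dg: "(g has_derivative ?G (f x)) (at (f x))"
      using Ck_on_has_derivative[OF Suc.prems(2)] x assms(5) by blast
    have "((\<lambda>x. g (f x)) has_derivative (\<lambda>v. ?G (f x) (?F x v))) (at x)"
      using has_derivative_compose[OF Ck_on_has_derivative[OF Suc.prems(1) x] dg] .
    then show "((\<lambda>x. g (f x)) has_derivative
        (\<lambda>v. \<Sum>b\<in>Basis. (?F x v \<bullet> b) *\<^sub>R ?G (f x) b)) (at x)"
      unfolding bounded_linear_Basis_expansion[OF has_derivative_bounded_linear[OF dg], symmetric] .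
  next
    fix v
    show "Ck_on k (\<lambda>x. \<Sum>b\<in>Basis. (?F x v \<bullet> b) *\<^sub>R ?G (f x) b) S"
    proof (intro Ck_on_sum Ck_on_bilinear[OF bounded_bilinear_scaleR] assms(1)
            Ck_on_linear_comp[OF bounded_linear_inner_left])
      show "Ck_on k (\<lambda>x. ?F x v) S" using Suc.prems(1) by simp
      show "Ck_on k (\<lambda>x. ?G (f x) b) S" for b
        using Suc.IH[OF f, of "\<lambda>y. ?G y b"] Suc.prems(2) by simp
    qed
  qed
qed

lemma smooth_on_subset: "smooth_on f S \<Longrightarrow> T \<subseteq> S \<Longrightarrow> smooth_on f T"
  unfolding smooth_on_def using Ck_on_subset by blast

lemma smooth_on_cong:
  "open S \<Longrightarrow> (\<And>x. x \<in> S \<Longrightarrow> f x = g x) \<Longrightarrow> smooth_on f S \<longleftrightarrow> smooth_on g S"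
  using Ck_on_cong[of S f g] unfolding smooth_on_def by simp

lemma smooth_on_has_derivative:
  "smooth_on f S \<Longrightarrow> x \<in> S \<Longrightarrow> (f has_derivative frechet_derivative f (at x)) (at x)"
  unfolding smooth_on_def using Ck_on_has_derivative by blast

lemma smooth_on_frechet_derivative:
  "smooth_on f S \<Longrightarrow> smooth_on (\<lambda>x. frechet_derivative f (at x) v) S"
  unfolding smooth_on_def
proof
  fix k assume "\<forall>k. Ck_on k f S"
  then have "Ck_on (Suc k) f S" ..
  then show "Ck_on k (\<lambda>x. frechet_derivative f (at x) v) S" by simp
qed

lemma smooth_on_imp_continuous_on: "smooth_on f S \<Longrightarrow> continuous_on S f"
  unfolding smooth_on_def by (metis Ck_on.simps(1))

lemma smooth_on_add:
  "open S \<Longrightarrow> smooth_on f S \<Longrightarrow> smooth_on g S \<Longrightarrow> smooth_on (\<lambda>x. f x + g x) S"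
  unfolding smooth_on_def by (simp add: Ck_on_add[of S _ f g])

lemma smooth_on_sum:
  "open S \<Longrightarrow> (\<And>i. i \<in> I \<Longrightarrow> smooth_on (f i) S) \<Longrightarrow> smooth_on (\<lambda>x. \<Sum>i\<in>I. f i x) S"
  unfolding smooth_on_def using Ck_on_sum[of S I _ f] by simp

lemma smooth_on_bilinear:
  "bounded_bilinear bil \<Longrightarrow> open S \<Longrightarrow> smooth_on f S \<Longrightarrow> smooth_on g S \<Longrightarrow>
     smooth_on (\<lambda>x. bil (f x) (g x)) S"
  unfolding smooth_on_def by (simp add: Ck_on_bilinear[of bil S _ f g])

lemma smooth_on_const: "smooth_on (\<lambda>x. c) S"
  unfolding smooth_on_def by (auto intro!: Ck_on_const)

lemma smooth_on_bounded_linear: "bounded_linear h \<Longrightarrow> open S \<Longrightarrow> smooth_on h S"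
  unfolding smooth_on_def by (auto intro!: Ck_on_bounded_linear)

lemma smooth_on_linear_comp:
  "bounded_linear h \<Longrightarrow> open S \<Longrightarrow> smooth_on f S \<Longrightarrow> smooth_on (\<lambda>x. h (f x)) S"
  unfolding smooth_on_def by (simp add: Ck_on_linear_comp[of h S _ f])

lemma smooth_on_diff:
  "open S \<Longrightarrow> smooth_on f S \<Longrightarrow> smooth_on g S \<Longrightarrow> smooth_on (\<lambda>x. f x - g x) S"
  using smooth_on_add[of S f "\<lambda>x. - g x"]
    smooth_on_linear_comp[OF bounded_linear_minus[OF bounded_linear_ident], of S g]
  by simp

lemma smooth_on_compose:
  fixes f :: "'a::real_normed_vector \<Rightarrow> 'b::euclidean_space"
  shows "open S \<Longrightarrow> open T \<Longrightarrow> smooth_on f S \<Longrightarrow> smooth_on g T \<Longrightarrow> f ` S \<subseteq> T \<Longrightarrow>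
     smooth_on (\<lambda>x. g (f x)) S"
  unfolding smooth_on_def using Ck_on_compose[of S T _ f g] by simp


section \<open>Smooth local inverses\<close>

lemma Ck_on_vec:
  fixes f :: "'a::real_normed_vector \<Rightarrow> real^'n"
  assumes "open S" "\<And>i. Ck_on k (\<lambda>x. f x $ i) S"
  shows "Ck_on k f S"
proof -
  have "Ck_on k (\<lambda>x. \<Sum>i\<in>UNIV. (f x $ i) *\<^sub>R (axis i 1 :: real^'n)) S"
    by (intro Ck_on_sum Ck_on_bilinear[OF bounded_bilinear_scaleR] assms Ck_on_const)
  moreover have "(\<lambda>x. \<Sum>i\<in>UNIV. (f x $ i) *\<^sub>R (axis i 1 :: real^'n)) = f"
    by (simp add: basis_expansion scalar_mult_eq_scaleR[symmetric])
  ultimately show ?thesis by simp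
qed

lemma Ck_on_det:
  fixes A :: "'a::real_normed_vector \<Rightarrow> real^'n^'n"
  assumes "open S" "\<And>i j. Ck_on k (\<lambda>x. A x $ i $ j) S"
  shows "Ck_on k (\<lambda>x. det (A x)) S"
  unfolding det_def
  by (intro Ck_on_sum Ck_on_bilinear[OF bounded_bilinear_mult] Ck_on_prod assms Ck_on_const)

text \<open>The inverse function theorem provides a differentiable local inverse \<open>g\<close> whose derivative is
  the inverse of the Jacobian of \<open>f\<close> at \<open>g y\<close>. By Cramer's rule the entries of that inverse are
  quotients of polynomials in the first derivatives of \<open>f\<close> at \<open>g y\<close>. So if \<open>g\<close> is $C^k$, its
  derivative is $C^k$, and \<open>g\<close> gains one order of smoothness at each step.\<close>

theorem smooth_local_inverse:
  fixes f :: "real^'n \<Rightarrow> real^'n"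
  assumes S: "open S" "a \<in> S" and f: "smooth_on f S" and inj: "inj (frechet_derivative f (at a))"
  obtains U V g where "open U" "a \<in> U" "U \<subseteq> S" "open V" "homeomorphism U V f g" "smooth_on g V"
proof -
  define f' where "f' x = Blinfun (frechet_derivative f (at x))" for x
  have bl: "bounded_linear (frechet_derivative f (at x))" if "x \<in> S" for x
    using has_derivative_bounded_linear[OF smooth_on_has_derivative[OF f that]] .
  have f': "blinfun_apply (f' x) = frechet_derivative f (at x)" if "x \<in> S" for x
    unfolding f'_def using bounded_linear_Blinfun_apply[OF bl[OF that]] .
  have der: "(f has_derivative blinfun_apply (f' x)) (at x)" if "x \<in> S" for x
    unfolding f'[OF that] using smooth_on_has_derivative[OF f that] .
  have contf': "continuous_on S f'"
  proof (rule continuous_on_blinfun_componentwise)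
    fix i
    show "continuous_on S (\<lambda>x. blinfun_apply (f' x) i)"
      using smooth_on_imp_continuous_on[OF smooth_on_frechet_derivative[OF f, of i]]
      by (rule continuous_on_eq) (simp add: f')
  qed
  obtain h where h: "linear h" "h \<circ> frechet_derivative f (at a) = id"
    using linear_injective_left_inverse[OF bounded_linear.linear[OF bl[OF S(2)]] inj] by blast
  have invf: "Blinfun h o\<^sub>L f' a = id_blinfun"
    using h bounded_linear_Blinfun_apply[of h] f'[OF S(2)]
    by (intro blinfun_eqI) (simp add: linear_conv_bounded_linear fun_eq_iff)
  obtain U V g g' where UV: "open U" "U \<subseteq> S" "a \<in> U" "open V" "f a \<in> V" "homeomorphism U V f g"
    and g: "\<And>y. y \<in> V \<Longrightarrow> (g has_derivative (g' y)) (at y)"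
      "\<And>y. y \<in> V \<Longrightarrow> g' y = inv (blinfun_apply (f' (g y)))"
      "\<And>y. y \<in> V \<Longrightarrow> bij (blinfun_apply (f' (g y)))"
    using inverse_function_theorem[OF S(1) der contf' S(2) invf] by metis
  define J :: "real^'n \<Rightarrow> real^'n^'n"
    where "J y = matrix (frechet_derivative f (at (g y)))" for y
  \<comment> \<open>the numerators in Cramer's rule: the Jacobian with its \<open>k\<close>-th column replaced by \<open>v\<close>\<close>
  define C :: "real^'n \<Rightarrow> 'n \<Rightarrow> real^'n \<Rightarrow> real^'n^'n"
    where "C v k y = (\<chi> i j. if j = k then v $ i else J y $ i $ j)" for v k y
  have gV: "g ` V \<subseteq> S" using UV(2,6) homeomorphism_image2 by blast
  have det_J: "det (J y) \<noteq> 0"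
    and g'_eq: "g' y v = (\<chi> k. det (C v k y) * inverse (det (J y)))" if y: "y \<in> V" for y v
  proof -
    let ?F = "frechet_derivative f (at (g y))"
    have gy: "g y \<in> S" using gV y by blast
    have lin: "linear ?F" using bl[OF gy] by (simp add: linear_conv_bounded_linear)
    have bij: "bij ?F" using g(3)[OF y] f'[OF gy] by simp
    have works: "J y *v u = ?F u" for u
      unfolding J_def using matrix_vector_mul(2)[OF lin] by metis
    show det: "det (J y) \<noteq> 0"
      unfolding J_def det_nz_iff_inj[OF lin] using bij by (rule bij_is_inj)
    have "?F (g' y v) = v"
      using g(2)[OF y] f'[OF gy] bij by (simp add: bij_is_surj surj_f_inv_f)
    then show "g' y v = (\<chi> k. det (C v k y) * inverse (det (J y)))"
      unfolding works[symmetric] cramer[OF det] C_def divide_inverse .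
  qed
  have "Ck_on k g V" for k
  proof (induction k)
    case 0
    then show ?case using UV(6) homeomorphism_cont2 by auto
  next
    case (Suc k)
    have J: "Ck_on k (\<lambda>y. J y $ i $ j) V" for i j
    proof -
      have "Ck_on k (\<lambda>y. frechet_derivative f (at (g y)) (axis j 1)) V"
        using Ck_on_compose[OF UV(4) S(1) Suc.IH _ gV]
          smooth_on_frechet_derivative[OF f] unfolding smooth_on_def by blast
      then show ?thesis
        unfolding J_def matrix_def
        using Ck_on_linear_comp[OF bounded_linear_vec_nth[of i] UV(4)] by simp
    qed
    have "Ck_on k (\<lambda>y. g' y v) V" for v
    proof -
      have "Ck_on k (\<lambda>y. C v l y $ i $ j) V" for l i j
        unfolding C_def by (cases "j = l") (simp_all add: J Ck_on_const)
      then have "Ck_on k (\<lambda>y. det (C v l y) * inverse (det (J y))) V" for l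
        by (intro Ck_on_bilinear[OF bounded_bilinear_mult] Ck_on_det Ck_on_inverse UV(4) det_J J)
      then have "Ck_on k (\<lambda>y. \<chi> l. det (C v l y) * inverse (det (J y))) V"
        by (intro Ck_on_vec UV(4)) simp
      then show ?thesis
        using Ck_on_cong[OF UV(4), of "\<lambda>y. g' y v"] g'_eq by simp
    qed
    then show ?case using Ck_on_SucI[OF UV(4) g(1)] by blast
  qed
  then show thesis
    using that UV unfolding smooth_on_def by blast
qed


section \<open>Symmetry of second derivatives\<close>

text \<open>The mean value theorem is applied first along \<open>v\<close>, to the difference of \<open>f\<close> between the two
  segments parallel to \<open>v\<close>, and then along \<open>w\<close>. The left hand side is symmetric in \<open>v\<close> and \<open>w\<close>,
  which is the source of the symmetry of the second derivative.\<close>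

lemma second_difference_mean_value:
  fixes f :: "'a::real_normed_vector \<Rightarrow> real"
  assumes f: "Ck_on 2 f S" and S: "ball x r \<subseteq> S" and t: "0 < t" "t * (norm v + norm w) < r"
  shows "\<exists>y. dist x y \<le> t * (norm v + norm w) \<and>
    f (x + t *\<^sub>R v + t *\<^sub>R w) - f (x + t *\<^sub>R v) - f (x + t *\<^sub>R w) + f x
      = t * t * frechet_derivative (\<lambda>z. frechet_derivative f (at z) v) (at y) w"
proof -
  define F where "F = (\<lambda>z. frechet_derivative f (at z) v)"
  have "Ck_on (Suc (Suc 0)) f S" using f by (simp add: numeral_2_eq_2)
  then have df: "(f has_derivative frechet_derivative f (at z)) (at z)"
    and dF: "(F has_derivative frechet_derivative F (at z)) (at z)" if "z \<in> S" for z
    using that Ck_on_has_derivative[of "Suc 0" f S z] Ck_on_has_derivative[of 0 F S z]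
    unfolding F_def by auto
  have bound: "norm (a *\<^sub>R v + b *\<^sub>R w) \<le> t * (norm v + norm w)"
    if "0 \<le> a" "a \<le> t" "0 \<le> b" "b \<le> t" for a b
  proof -
    have "norm (a *\<^sub>R v + b *\<^sub>R w) \<le> a * norm v + b * norm w"
      using norm_triangle_ineq[of "a *\<^sub>R v" "b *\<^sub>R w"] that by simp
    also have "\<dots> \<le> t * norm v + t * norm w"
      using that by (intro add_mono mult_right_mono) auto
    finally show ?thesis by (simp add: algebra_simps)
  qed
  have in_S: "x + a *\<^sub>R v + b *\<^sub>R w \<in> S" if "0 \<le> a" "a \<le> t" "0 \<le> b" "b \<le> t" for a b
  proof -
    have "dist x (x + a *\<^sub>R v + b *\<^sub>R w) = norm (a *\<^sub>R v + b *\<^sub>R w)"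
      by (metis add.assoc add_diff_cancel_left' dist_commute dist_norm)
    then show ?thesis using bound[OF that] t S by (auto simp: subset_iff)
  qed
  have "((\<lambda>s. f (x + s *\<^sub>R v + b *\<^sub>R w)) has_field_derivative F (x + s *\<^sub>R v + b *\<^sub>R w)) (at s)"
    if "0 \<le> s" "s \<le> t" "0 \<le> b" "b \<le> t" for s b
  proof -
    have d: "((\<lambda>s. x + s *\<^sub>R v + b *\<^sub>R w) has_derivative (\<lambda>h. h *\<^sub>R v)) (at s)"
      by (auto intro!: derivative_eq_intros)
    have "linear (frechet_derivative f (at (x + s *\<^sub>R v + b *\<^sub>R w)))"
      using has_derivative_linear[OF df[OF in_S[OF that]]] .
    then show ?thesis
      using has_derivative_compose[OF d df[OF in_S[OF that]]]
      by (simp add: has_field_derivative_def F_def linear_cmul mult_commute_abs)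
  qed
  from MVT2[OF t(1) DERIV_diff[OF this[of _ t] this[of _ 0]]]
  obtain a where a: "0 < a" "a < t"
    "(f (x + t *\<^sub>R v + t *\<^sub>R w) - f (x + t *\<^sub>R v)) - (f (x + t *\<^sub>R w) - f x)
       = t * (F (x + a *\<^sub>R v + t *\<^sub>R w) - F (x + a *\<^sub>R v))"
    using t(1) by auto
  have "((\<lambda>s. F (x + a *\<^sub>R v + s *\<^sub>R w)) has_field_derivative
      frechet_derivative F (at (x + a *\<^sub>R v + s *\<^sub>R w)) w) (at s)"
    if "0 \<le> s" "s \<le> t" for s
  proof -
    have d: "((\<lambda>s. x + a *\<^sub>R v + s *\<^sub>R w) has_derivative (\<lambda>h. h *\<^sub>R w)) (at s)"
      by (auto intro!: derivative_eq_intros)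
    have D: "(F has_derivative frechet_derivative F (at (x + a *\<^sub>R v + s *\<^sub>R w)))
        (at (x + a *\<^sub>R v + s *\<^sub>R w))"
      using that a by (intro dF in_S) auto
    show ?thesis
      using has_derivative_compose[OF d D] has_derivative_linear[OF D]
      by (simp add: has_field_derivative_def linear_cmul mult_commute_abs)
  qed
  from MVT2[OF t(1) this]
  obtain b where b: "0 < b" "b < t"
    "F (x + a *\<^sub>R v + t *\<^sub>R w) - F (x + a *\<^sub>R v)
       = t * frechet_derivative F (at (x + a *\<^sub>R v + b *\<^sub>R w)) w"
    by auto
  have "dist x (x + a *\<^sub>R v + b *\<^sub>R w) \<le> t * (norm v + norm w)"
    using bound[of a b] a b by (simp add: dist_norm add.assoc) (metis norm_minus_cancel minus_add_distrib
      add_uminus_conv_diff add.commute)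
  then show ?thesis
    using a(3) b(3) unfolding F_def by (intro exI[of _ "x + a *\<^sub>R v + b *\<^sub>R w"]) simp
qed

text \<open>Schwarz's theorem. At suitable points near \<open>x\<close> both mixed derivatives are equal to the same second
  difference quotient, so by continuity they agree at \<open>x\<close>.\<close>

theorem second_derivative_symmetric:
  fixes f :: "'a::real_normed_vector \<Rightarrow> real"
  assumes S: "open S" "x \<in> S" and f: "Ck_on 2 f S"
  shows "frechet_derivative (\<lambda>z. frechet_derivative f (at z) v) (at x) w
       = frechet_derivative (\<lambda>z. frechet_derivative f (at z) w) (at x) v"
    (is "?D v w x = ?D w v x")
proof (rule ccontr)
  assume neq: "?D v w x \<noteq> ?D w v x"
  define e where "e = \<bar>?D v w x - ?D w v x\<bar> / 2"
  have e: "e > 0" using neq by (simp add: e_def)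
  have "Ck_on 0 (?D v w) S" for v w
    using f unfolding numeral_2_eq_2 Ck_on.simps(2) by blast
  then have cont: "isCont (?D v w) x" for v w
    using S continuous_on_eq_continuous_at Ck_on.simps(1) by blast
  obtain d where d: "d > 0" "\<And>y. dist y x < d \<Longrightarrow> \<bar>?D v w y - ?D v w x\<bar> < e"
    using cont[of v w] e unfolding continuous_at_eps_delta dist_real_def by blast
  obtain d' where d': "d' > 0" "\<And>y. dist y x < d' \<Longrightarrow> \<bar>?D w v y - ?D w v x\<bar> < e"
    using cont[of w v] e unfolding continuous_at_eps_delta dist_real_def by blast
  obtain r where r: "r > 0" "ball x r \<subseteq> S" using S openE by blast
  define R where "R = Min {r, d, d'}"
  have R: "R > 0" "R \<le> r" "R \<le> d" "R \<le> d'" using r d d' by (auto simp: R_def)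
  define t where "t = R / (norm v + norm w + 1)"
  have pos: "norm v + norm w + 1 > 0" by (simp add: add_nonneg_pos)
  have t: "t > 0" using R pos by (simp add: t_def)
  have tR: "t * (norm v + norm w) < R"
    using R pos unfolding t_def by (simp add: field_simps)
  obtain y where y: "dist x y \<le> t * (norm v + norm w)"
    "f (x + t *\<^sub>R v + t *\<^sub>R w) - f (x + t *\<^sub>R v) - f (x + t *\<^sub>R w) + f x = t * t * ?D v w y"
    using second_difference_mean_value[OF f r(2) t, of v w] tR R by auto
  obtain y' where y': "dist x y' \<le> t * (norm w + norm v)"
    "f (x + t *\<^sub>R w + t *\<^sub>R v) - f (x + t *\<^sub>R w) - f (x + t *\<^sub>R v) + f x = t * t * ?D w v y'"
    using second_difference_mean_value[OF f r(2) t, of w v] tR R by (auto simp: add.commute)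
  have "t * t * ?D v w y = t * t * ?D w v y'"
    using y(2) y'(2) by (simp add: algebra_simps)
  then have eq: "?D v w y = ?D w v y'" using t by simp
  have "\<bar>?D v w y - ?D v w x\<bar> < e"
    using d(2)[of y] y(1) tR R by (simp add: dist_commute)
  moreover have "\<bar>?D w v y' - ?D w v x\<bar> < e"
    using d'(2)[of y'] y'(1) tR R by (simp add: dist_commute add.commute)
  ultimately show False using eq unfolding e_def by argo
qed

lemma hessian_in_Sym2:
  assumes "open S" "x \<in> S" "smooth_on f S"
  shows "hessian f x \<in> Sym2"
  using second_derivative_symmetric[OF assms(1,2)] assms(3)
  unfolding Sym2_def hessian_def transpose_def smooth_on_def by (simp add: vec_eq_iff)

lemma continuous_on_hessian:
  assumes "smooth_on f S"
  shows "continuous_on S (hessian f)"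
  unfolding hessian_def
  by (intro continuous_on_vec_lambda smooth_on_imp_continuous_on smooth_on_frechet_derivative assms)

text \<open>The interior is relative to \<open>Sym2\<close>, so continuity of the Hessian alone would not
  keep it there; its symmetry at nearby points is what makes the condition open.\<close>

lemma strictly_psh_at_open_nhd:
  assumes "strictly_psh_at P f x"
  obtains U where "open U" "x \<in> U" "\<And>y. y \<in> U \<Longrightarrow> strictly_psh_at P f y"
proof -
  obtain W where W: "open W" "x \<in> W" "smooth_on f W"
    using assms unfolding strictly_psh_at_def smooth_near_def by blast
  obtain O' where O': "open O'" "(top_of_set Sym2) interior_of P = Sym2 \<inter> O'"
    using openin_interior_of[of "top_of_set Sym2" P] unfolding openin_open by blast
  show thesis
  proof
    show "open (W \<inter> hessian f -` O')"
      using continuous_open_preimage[OF continuous_on_hessian[OF W(3)] W(1) O'(1)] .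
    show "x \<in> W \<inter> hessian f -` O'"
      using assms W O' unfolding strictly_psh_at_def by blast
    show "strictly_psh_at P f y" if "y \<in> W \<inter> hessian f -` O'" for y
      using that W O' hessian_in_Sym2[OF W(1) _ W(3)]
      unfolding strictly_psh_at_def smooth_near_def by blast
  qed
qed


section \<open>Duality for cones of quadratic forms\<close>

text \<open>The trace form is the Euclidean inner product of matrices as soon as one argument is
  symmetric, which makes the theory of closest points and of compact spheres available.\<close>

lemma inner_eq_trace:
  fixes A B :: "real^'n^'n"
  assumes "B \<in> Sym2"
  shows "A \<bullet> B = trace (A ** B)"
proof -
  have "B $ i $ j = B $ j $ i" for i j
    using assms by (simp add: Sym2_def transpose_def vec_eq_iff)
  then show ?thesis
    by (simp add: inner_vec_def trace_def matrix_matrix_mult_def)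
qed

lemma subspace_Sym2: "subspace (Sym2 :: (real^'n^'n) set)"
  by (auto simp: Sym2_def subspace_def transpose_def vec_eq_iff)

lemma closed_polar:
  fixes P :: "(real^'n^'n) set"
  assumes "P \<subseteq> Sym2"
  shows "closed (polar P)"
proof -
  have "polar P = Sym2 \<inter> (\<Inter>B\<in>P. {A. 0 \<le> A \<bullet> B})"
    unfolding polar_def using assms by (auto simp: inner_eq_trace subset_iff)
  then show ?thesis
    using closed_subspace[OF subspace_Sym2] closed_halfspace_ge[where b = 0]
    by (auto intro!: closed_Int closed_INT simp: inner_commute)
qed

text \<open>Let \<open>C\<close> be the point of \<open>P\<close> closest to \<open>B\<close>. Because \<open>P\<close> is a cone, \<open>A = C - B\<close> belongs to the
  polar and pairs nonpositively with \<open>C\<close>. If \<open>A\<close> were nonzero, it would pair negatively with \<open>B\<close>,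
  against the hypothesis; so \<open>B = C\<close>.\<close>

lemma bipolar:
  fixes P :: "(real^'n^'n) set"
  assumes P: "P \<subseteq> Sym2" "closed P" "convex_cone P"
    and B: "B \<in> Sym2" "\<And>A. A \<in> polar P \<Longrightarrow> 0 \<le> A \<bullet> B"
  shows "B \<in> P"
proof -
  have conv: "convex P" and ne: "P \<noteq> {}" using P(3) unfolding convex_cone_def by auto
  define C where "C = closest_point P B"
  define A where "A = C - B"
  have C: "C \<in> P" unfolding C_def using closest_point_in_set P(2) ne .
  have ineq: "0 \<le> A \<bullet> (D - C)" if "D \<in> P" for D
    using closest_point_dot[OF conv P(2) that, of B] unfolding A_def C_def
    by (simp add: inner_diff_left)
  have A_Sym2: "A \<in> Sym2"
    unfolding A_def using C P(1) B(1) subspace_diff[OF subspace_Sym2] by blast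
  have AD: "0 \<le> A \<bullet> D" if "D \<in> P" for D
    using ineq[OF convex_cone_add[OF P(3) C that]] by simp
  have "0 \<in> P" using P(3) by (simp add: convex_cone_iff)
  then have AC: "A \<bullet> C \<le> 0" using ineq[of 0] by (simp add: inner_diff_right)
  have "A \<in> polar P"
    using A_Sym2 AD P(1) by (auto simp: polar_def subset_iff inner_eq_trace[symmetric])
  then have "0 \<le> A \<bullet> B" using B(2) by blast
  moreover have "A \<bullet> A = A \<bullet> C - A \<bullet> B" by (simp add: A_def inner_diff_right)
  ultimately have "A \<bullet> A \<le> 0" using AC by linarith
  then have "A = 0" using inner_gt_zero_iff[of A] by linarith
  then show ?thesis using C by (simp add: A_def)
qed

text \<open>If \<open>B\<close> is interior, then \<open>B - e A\<close> is still in \<open>P\<close> for small \<open>e > 0\<close>, and pairing it with \<open>A\<close>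
  gives a strict inequality. Conversely, by compactness the pairing with \<open>B\<close> has a positive lower
  bound \<open>c\<close> on the unit vectors of the polar, so everything within distance \<open>c\<close> of \<open>B\<close> pairs
  nonnegatively with the polar and lies in \<open>P\<close> by the bipolar theorem.\<close>

lemma interior_iff_positive_on_polar:
  fixes P :: "(real^'n^'n) set"
  assumes P: "P \<subseteq> Sym2" "closed P" "convex_cone P" and B: "B \<in> Sym2"
  shows "B \<in> (top_of_set Sym2) interior_of P \<longleftrightarrow> (\<forall>A \<in> polar P - {0}. 0 < A \<bullet> B)"
proof
  assume "B \<in> (top_of_set Sym2) interior_of P"
  then obtain T where T: "open T" "B \<in> T" "Sym2 \<inter> T \<subseteq> P"
    unfolding interior_of_def openin_open by auto
  then obtain r where r: "r > 0" "ball B r \<subseteq> T" using openE by blast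
  show "\<forall>A \<in> polar P - {0}. 0 < A \<bullet> B"
  proof
    fix A assume A: "A \<in> polar P - {0}"
    define e where "e = r / (2 * norm A)"
    have nA: "norm A > 0" using A by simp
    have e: "e > 0" using r nA by (simp add: e_def)
    have "A \<in> Sym2" using A by (simp add: polar_def)
    then have S: "B - e *\<^sub>R A \<in> Sym2"
      using B subspace_diff[OF subspace_Sym2] subspace_scale[OF subspace_Sym2] by blast
    have "dist B (B - e *\<^sub>R A) = r / 2" using e nA r by (simp add: dist_norm e_def)
    then have "B - e *\<^sub>R A \<in> P" using r T S by (auto simp: subset_iff)
    then have "0 \<le> A \<bullet> (B - e *\<^sub>R A)" using A S by (simp add: polar_def inner_eq_trace)
    moreover have "e * (A \<bullet> A) > 0" using e A by simp
    ultimately show "0 < A \<bullet> B" by (simp add: inner_diff_right)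
  qed
next
  assume pos: "\<forall>A \<in> polar P - {0}. 0 < A \<bullet> B"
  define K where "K = polar P \<inter> sphere 0 1"
  have K: "compact K"
    unfolding K_def using compact_sphere closed_polar[OF P(1)] by (simp add: closed_Int_compact)
  obtain c where c: "c > 0" "\<And>A. A \<in> K \<Longrightarrow> c \<le> A \<bullet> B"
  \<comment> \<open>if the polar is trivial, then \<open>P\<close> is all of \<open>Sym2\<close> and any radius will do\<close>
  proof (cases "K = {}")
    case True
    then show thesis using that[of 1] by simp
  next
    case False
    obtain A0 where "A0 \<in> K" "\<And>A. A \<in> K \<Longrightarrow> A0 \<bullet> B \<le> A \<bullet> B"
      using continuous_attains_inf[OF K False
          continuous_on_inner[OF continuous_on_id continuous_on_const[of K B]]] by auto
    moreover have "A0 \<noteq> 0" "A0 \<in> polar P" using \<open>A0 \<in> K\<close> by (auto simp: K_def)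
    ultimately show thesis using that[of "A0 \<bullet> B"] pos by blast
  qed
  have "Sym2 \<inter> ball B c \<subseteq> P"
  proof
    fix D assume D: "D \<in> Sym2 \<inter> ball B c"
    show "D \<in> P"
    proof (rule bipolar[OF P])
      show "D \<in> Sym2" using D by simp
      fix A assume A: "A \<in> polar P"
      show "0 \<le> A \<bullet> D"
      proof (cases "A = 0")
        case False
        define A' where "A' = A /\<^sub>R norm A"
        have "A' \<in> Sym2"
          using A subspace_scale[OF subspace_Sym2] unfolding A'_def polar_def by blast
        moreover have "0 \<le> A' \<bullet> Q" if "Q \<in> P" for Q
          using A that P(1) by (auto simp: A'_def polar_def inner_eq_trace subset_iff)
        ultimately have "A' \<in> polar P"
          using P(1) by (auto simp: polar_def subset_iff inner_eq_trace[symmetric])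
        moreover have nA': "norm A' = 1" using False by (simp add: A'_def)
        ultimately have "c \<le> A' \<bullet> B" using c(2) unfolding K_def by simp
        moreover have "\<bar>A' \<bullet> (B - D)\<bar> \<le> norm A' * norm (B - D)"
          by (rule Cauchy_Schwarz_ineq2)
        moreover note nA'
        moreover have "norm (B - D) < c" using D by (simp add: dist_norm)
        ultimately have "0 \<le> A' \<bullet> D" by (simp add: inner_diff_right)
        moreover have "A \<bullet> D = norm A * (A' \<bullet> D)" using False by (simp add: A'_def)
        ultimately show ?thesis by simp
      qed simp
    qed
  qed
  moreover have "openin (top_of_set Sym2) (Sym2 \<inter> ball B c)"
    by (simp add: openin_open_Int)
  moreover have "B \<in> Sym2 \<inter> ball B c" using B c(1) by simp
  ultimately show "B \<in> (top_of_set Sym2) interior_of P"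
    unfolding interior_of_def by blast
qed

text \<open>With \<open>w = A v\<close>, the nonnegative quadratic \<open>t \<mapsto> (v + t w) \<bullet> A (v + t w)\<close> has constant term \<open>0\<close>,
  hence its linear coefficient \<open>2 \<bar>w\<bar>\<^sup>2\<close> vanishes.\<close>

lemma psd_kernel:
  fixes A :: "real^'n^'n"
  assumes A: "A \<in> psd" and v: "v \<bullet> (A *v v) = 0"
  shows "A *v v = 0"
proof -
  define w where "w = A *v v"
  have sym: "x \<bullet> (A *v y) = (A *v x) \<bullet> y" for x y
    using A dot_lmul_matrix[of x A y] transpose_matrix_vector[of A x]
    by (simp add: psd_def Sym2_def)
  have q: "0 \<le> 2 * t * (w \<bullet> w) + t * t * (w \<bullet> (A *v w))" for t
  proof -
    have "0 \<le> (v + t *\<^sub>R w) \<bullet> (A *v (v + t *\<^sub>R w))"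
      using A unfolding psd_def by blast
    also have "\<dots> = 2 * t * (w \<bullet> w) + t * t * (w \<bullet> (A *v w))"
      using v sym[of v w] w_def
      by (simp add: matrix_vector_right_distrib matrix_vector_mult_scaleR inner_add_left
        inner_add_right inner_commute algebra_simps)
    finally show ?thesis .
  qed
  define b where "b = w \<bullet> (A *v w)"
  have b: "b \<ge> 0" using A unfolding b_def psd_def by blast
  have "w \<bullet> w = 0"
  proof (rule ccontr)
    assume "w \<bullet> w \<noteq> 0"
    then have pos: "w \<bullet> w > 0" using inner_ge_zero[of w] by linarith
    \<comment> \<open>a negative \<open>t\<close> so small that the linear term dominates; \<open>b + 1\<close> avoids dividing by \<open>0\<close>\<close>
    define t where "t = - (w \<bullet> w) / (b + 1)"
    have t: "t < 0" using pos b by (simp add: t_def divide_neg_pos)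
    have "0 \<le> t * (2 * (w \<bullet> w) + t * b)" using q[of t] by (simp add: b_def algebra_simps)
    then have "2 * (w \<bullet> w) + t * b \<le> 0" using t by (simp add: zero_le_mult_iff)
    moreover have "t * b = - ((w \<bullet> w) * (b / (b + 1)))" by (simp add: t_def)
    moreover have "(w \<bullet> w) * (b / (b + 1)) \<le> (w \<bullet> w) * 1"
      using b pos by (intro mult_left_mono) auto
    ultimately show False using pos by linarith
  qed
  then show ?thesis by (simp add: w_def)
qed

lemma inner_gram:
  fixes A G :: "real^'n^'n"
  shows "A \<bullet> (transpose G ** G) = (\<Sum>i\<in>UNIV. row i G \<bullet> (A *v row i G))"
proof -
  have "A \<bullet> (transpose G ** G) = (\<Sum>j\<in>UNIV. \<Sum>k\<in>UNIV. \<Sum>i\<in>UNIV. A $ j $ k * (G $ i $ j * G $ i $ k))"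
    by (simp add: inner_vec_def matrix_matrix_mult_def transpose_def sum_distrib_left)
  also have "\<dots> = (\<Sum>j\<in>UNIV. \<Sum>i\<in>UNIV. \<Sum>k\<in>UNIV. A $ j $ k * (G $ i $ j * G $ i $ k))"
    by (intro sum.cong refl sum.swap)
  also have "\<dots> = (\<Sum>i\<in>UNIV. \<Sum>j\<in>UNIV. \<Sum>k\<in>UNIV. A $ j $ k * (G $ i $ j * G $ i $ k))"
    by (rule sum.swap)
  also have "\<dots> = (\<Sum>i\<in>UNIV. row i G \<bullet> (A *v row i G))"
    by (simp add: inner_vec_def matrix_vector_mult_def row_def sum_distrib_left mult_ac)
  finally show ?thesis .
qed

text \<open>By \<open>inner_gram\<close>, a polar form \<open>A\<close>, being positive semidefinite, is orthogonal to \<open>G\<^sup>t G\<close> if and only if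
  it annihilates all rows of \<open>G\<close>, that is, the orthogonal complement of the kernel \<open>W\<close> of \<open>G\<close>. So
  freeness of \<open>W\<close> says that no nonzero polar form is orthogonal to \<open>G\<^sup>t G\<close>. The factor
  \<open>c\<close> accommodates the \<open>2\<close> in the Hessian of a squared norm.\<close>

lemma free_iff_gram_interior:
  fixes P :: "(real^'n^'n) set" and G :: "real^'n^'n"
  assumes P: "P \<subseteq> Sym2" "closed P" "convex_cone P" "positivity_condition P"
    and W: "W = {v. G *v v = 0}" and c: "c > 0"
  shows "free_subspace P W \<longleftrightarrow> c *\<^sub>R (transpose G ** G) \<in> (top_of_set Sym2) interior_of P"
proof -
  have sub: "subspace W"
    unfolding W by (auto simp: subspace_def matrix_vector_right_distrib matrix_vector_mult_scaleR)
  have "transpose G ** G \<in> Sym2" by (simp add: Sym2_def matrix_transpose_mul)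
  then have H: "c *\<^sub>R (transpose G ** G) \<in> Sym2" using subspace_scale[OF subspace_Sym2] by blast
  have perp: "orthogonal_comp W = span (rows G)"
  proof -
    have "W = orthogonal_comp (span (rows G))"
      unfolding W orthogonal_comp_def orthogonal_def
    proof (intro Collect_cong iffI)
      fix v assume v: "G *v v = 0"
      have "row i G \<bullet> v = 0" for i
        using v by (metis matrix_mult_dot row_def vec_nth_inverse vec_lambda_beta zero_index)
      then have "rows G \<subseteq> {x. x \<bullet> v = 0}" by (auto simp: rows_def)
      moreover have "subspace {x. x \<bullet> v = 0}"
        using subspace_hyperplane[of v] by (simp add: inner_commute)
      ultimately show "\<forall>y\<in>span (rows G). y \<bullet> v = 0" using span_minimal by blast
    next
      fix v assume "\<forall>y\<in>span (rows G). y \<bullet> v = 0"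
      moreover have "row i G \<in> span (rows G)" for i by (auto simp: rows_def intro: span_base)
      ultimately have "row i G \<bullet> v = 0" for i by blast
      then show "G *v v = 0" by (simp add: matrix_mult_dot vec_eq_iff row_def vec_nth_inverse)
    qed
    then show ?thesis by (simp add: orthogonal_comp_self)
  qed
  have vanish: "A \<in> Sym2_on W \<longleftrightarrow> A \<bullet> (transpose G ** G) = 0"
    and nonneg: "0 \<le> A \<bullet> (transpose G ** G)" if A: "A \<in> polar P" for A
  proof -
    have psd: "A \<in> psd" using A P(4) unfolding positivity_condition_def by blast
    then have pos: "0 \<le> row i G \<bullet> (A *v row i G)" for i unfolding psd_def by blast
    show "0 \<le> A \<bullet> (transpose G ** G)" unfolding inner_gram using pos by (simp add: sum_nonneg)
    have "A \<bullet> (transpose G ** G) = 0 \<longleftrightarrow> (\<forall>i. row i G \<bullet> (A *v row i G) = 0)"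
      unfolding inner_gram using pos by (simp add: sum_nonneg_eq_0_iff)
    also have "\<dots> \<longleftrightarrow> rows G \<subseteq> {v. A *v v = 0}"
    proof
      assume *: "rows G \<subseteq> {v. A *v v = 0}"
      have "row i G \<in> rows G" for i by (auto simp: rows_def)
      then have "A *v row i G = 0" for i using * by blast
      then show "\<forall>i. row i G \<bullet> (A *v row i G) = 0" by simp
    qed (use psd_kernel[OF psd] in \<open>auto simp: rows_def\<close>)
    also have "\<dots> \<longleftrightarrow> span (rows G) \<subseteq> {v. A *v v = 0}"
    proof -
      have "subspace {v. A *v v = 0}"
        by (auto simp: subspace_def matrix_vector_right_distrib matrix_vector_mult_scaleR)
      then show ?thesis by (meson span_minimal span_superset subset_trans)
    qed
    also have "\<dots> \<longleftrightarrow> A \<in> Sym2_on W"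
      using psd unfolding Sym2_on_def perp psd_def by auto
    finally show "A \<in> Sym2_on W \<longleftrightarrow> A \<bullet> (transpose G ** G) = 0" by blast
  qed
  have zero: "0 \<in> polar P \<inter> Sym2_on W"
  proof -
    have "(0 :: real^'n^'n) \<in> Sym2" using subspace_0[OF subspace_Sym2] .
    then show ?thesis using P(1) by (auto simp: polar_def Sym2_on_def inner_eq_trace[symmetric] subset_iff)
  qed
  have "free_subspace P W \<longleftrightarrow> (\<forall>A \<in> polar P - {0}. A \<bullet> (transpose G ** G) \<noteq> 0)"
    unfolding free_subspace_def using sub zero vanish by auto
  also have "\<dots> \<longleftrightarrow> (\<forall>A \<in> polar P - {0}. 0 < A \<bullet> (c *\<^sub>R (transpose G ** G)))"
    using nonneg c by (auto simp: zero_less_mult_iff less_le)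
  finally show ?thesis unfolding interior_iff_positive_on_polar[OF P(1-3) H] .
qed


section \<open>The distance to a submanifold\<close>

lemma orthogonal_projection_exists:
  fixes L :: "'a::euclidean_space set"
  assumes L: "subspace L"
  obtains p where "linear p" "\<And>z. p z \<in> L" "\<And>z l. l \<in> L \<Longrightarrow> (z - p z) \<bullet> l = 0"
    "\<And>z. z \<in> L \<Longrightarrow> p z = z" "\<And>z. (\<And>l. l \<in> L \<Longrightarrow> z \<bullet> l = 0) \<Longrightarrow> p z = 0"
proof -
  obtain B where B: "B \<subseteq> L" "pairwise orthogonal B" "\<And>x. x \<in> B \<Longrightarrow> norm x = 1"
    "independent B" "span B = L"
    using orthonormal_basis_subspace[OF L] by metis
  have fin: "finite B" using B(4) by (rule independent_imp_finite)
  define p where "p z = (\<Sum>b\<in>B. (z \<bullet> b) *\<^sub>R b)" for z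
  have lin: "linear p"
    unfolding p_def
    by (intro linear_compose_sum ballI linearI) (auto simp: inner_add_left scaleR_add_left)
  have pL: "p z \<in> L" for z
    unfolding p_def using B(1) L by (intro subspace_sum) (auto intro: subspace_scale)
  have perp: "(z - p z) \<bullet> l = 0" if "l \<in> L" for z l
  proof -
    have "(z - p z) \<bullet> c = 0" if c: "c \<in> B" for c
    proof -
      have "(\<Sum>b\<in>B. (z \<bullet> b) * (b \<bullet> c)) = (\<Sum>b\<in>B. if b = c then z \<bullet> c else 0)"
        using B(2,3) c by (intro sum.cong)
          (auto simp: pairwise_def orthogonal_def norm_eq_1)
      then show ?thesis using fin c by (simp add: p_def inner_diff_left inner_sum_left)
    qed
    then have "span B \<subseteq> {l. (z - p z) \<bullet> l = 0}"
      by (intro span_minimal subspace_hyperplane) blast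
    then show ?thesis using that B(5) by blast
  qed
  have "p z = z" if "z \<in> L" for z
    using perp[of "z - p z" z] that pL L by (simp add: subspace_diff)
  moreover have "p z = 0" if "\<And>l. l \<in> L \<Longrightarrow> z \<bullet> l = 0" for z
    using perp[OF pL[of z], of z] that[OF pL[of z]] by (simp add: inner_diff_left)
  ultimately show thesis using that lin pL perp by blast
qed

text \<open>The sum on the left is the transpose of \<open>f\<close> applied to \<open>w\<close>, in a form whose smooth dependence
  on \<open>f\<close> is evident.\<close>

lemma inner_transpose:
  fixes f :: "'a::euclidean_space \<Rightarrow> 'b::real_inner"
  assumes "bounded_linear f"
  shows "(\<Sum>b\<in>Basis. (w \<bullet> f b) *\<^sub>R b) \<bullet> v = w \<bullet> f v"
  by (simp add: bounded_linear_Basis_expansion[OF assms, of v] inner_sum_left inner_sum_right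
      inner_commute mult.commute)

lemma derivative_left_inverse:
  assumes "open S" "x \<in> S" "(f has_derivative f') (at x)" "(g has_derivative g') (at (f x))"
    and "\<And>z. z \<in> S \<Longrightarrow> g (f z) = z"
  shows "g' (f' v) = v"
proof -
  have "((\<lambda>z. z) has_derivative (\<lambda>v. g' (f' v))) (at x)"
    using has_derivative_transform_within_open[OF has_derivative_compose[OF assms(3,4)] assms(1,2,5)]
    by simp
  then have "(\<lambda>v. g' (f' v)) = (\<lambda>v. v)"
    using has_derivative_unique has_derivative_ident by blast
  then show ?thesis by meson
qed

text \<open>\<open>M\<close> need not be closed in the ambient space, so nearest points may fail to exist far away. Near
  \<open>x\<close> the part of \<open>M\<close> in a small closed ball is closed, and points outside the ball are too far
  away to compete.\<close>

lemma nearest_point_locally: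
  fixes M X :: "'a::euclidean_space set"
  assumes X: "open X" and M: "closedin (top_of_set X) M" and x: "x \<in> M"
  obtains R where "R > 0"
    "\<And>y. dist y x < R \<Longrightarrow> \<exists>m\<in>M. infdist y M = dist y m \<and> dist m x \<le> 2 * dist y x"
proof -
  obtain C where C: "closed C" "M = X \<inter> C" using M unfolding closedin_closed by blast
  obtain r where r: "r > 0" "cball x r \<subseteq> X" using X x C open_contains_cball by blast
  define K where "K = M \<inter> cball x r"
  have "K = C \<inter> cball x r" using C r unfolding K_def by blast
  then have K: "closed K" using C by auto
  have xK: "x \<in> K" using x r by (simp add: K_def)
  show thesis
  proof
    show "r / 2 > 0" using r by simp
    fix y assume y: "dist y x < r / 2"
    obtain m where m: "m \<in> K" "\<And>k. k \<in> K \<Longrightarrow> dist y m \<le> dist y k"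
      using distance_attains_inf[OF K, of y] xK by auto
    have yx: "dist y m \<le> dist y x" using m(2) xK by blast
    have "dist y m \<le> dist y k" if "k \<in> M" for k
    proof (cases "k \<in> K")
      case False
      then have "dist x k > r" using that by (simp add: K_def)
      then show ?thesis using yx y dist_triangle[of x k y] by (simp add: dist_commute)
    qed (rule m(2))
    then have "dist y m \<le> infdist y M"
      using x unfolding infdist_def by (auto intro: cINF_greatest)
    moreover have "infdist y M \<le> dist y m" using m(1) by (simp add: K_def infdist_le)
    moreover have "dist m x \<le> 2 * dist y x"
      using yx dist_triangle[of m x y] by (simp add: dist_commute)
    ultimately show "\<exists>m\<in>M. infdist y M = dist y m \<and> dist m x \<le> 2 * dist y x"
      using m(1) by (intro bexI[of _ m]) (auto simp: K_def)
  qed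
qed

lemma nearest_point_critical:
  fixes \<psi> :: "'a::real_normed_vector \<Rightarrow> 'b::euclidean_space"
  assumes V: "open V" "u \<in> V" and \<psi>: "(\<psi> has_derivative D) (at u)"
    and min: "\<And>t. u + t *\<^sub>R l \<in> V \<Longrightarrow> dist y (\<psi> u) \<le> dist y (\<psi> (u + t *\<^sub>R l))"
  shows "(y - \<psi> u) \<bullet> D l = 0"
proof -
  define F where "F t = (y - \<psi> (u + t *\<^sub>R l)) \<bullet> (y - \<psi> (u + t *\<^sub>R l))" for t :: real
  define S where "S = (\<lambda>t::real. u + t *\<^sub>R l) -` V"
  have S: "open S" unfolding S_def by (intro open_vimage V continuous_intros)
  have d: "((\<lambda>t::real. u + t *\<^sub>R l) has_derivative (\<lambda>h. h *\<^sub>R l)) (at 0)"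
    by (auto intro!: derivative_eq_intros)
  have "((\<lambda>t::real. \<psi> (u + t *\<^sub>R l)) has_derivative (\<lambda>h. D (h *\<^sub>R l))) (at 0)"
    using has_derivative_compose[OF d] \<psi> by simp
  then have "(F has_derivative (\<lambda>h. 2 * ((y - \<psi> u) \<bullet> (- D (h *\<^sub>R l))))) (at 0)"
    unfolding F_def by (auto intro!: derivative_eq_intros simp: inner_commute)
  moreover have "F 0 \<le> F t" if "t \<in> S" for t
    using min[of t] that unfolding F_def S_def
    by (simp add: dist_norm power2_norm_eq_inner[symmetric] power_mono)
  ultimately have "(\<lambda>h. 2 * ((y - \<psi> u) \<bullet> (- D (h *\<^sub>R l)))) = (\<lambda>v. 0)"
    using differential_zero_maxmin[of 0 S F] S V(2) by (auto simp: S_def)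
  from fun_cong[OF this, of 1] show ?thesis by simp
qed

text \<open>Write \<open>p\<close> for the orthogonal projection onto the model subspace \<open>L\<close> of a chart \<open>\<phi>\<close> with inverse
  \<open>\<psi>\<close>. The map \<open>E\<close> below sends \<open>u + w\<close>, with \<open>u \<in> L\<close> and \<open>w\<close> orthogonal to \<open>L\<close>, to the point
  \<open>\<psi> u\<close> of \<open>M\<close> plus the transposed derivative of \<open>\<phi>\<close> applied to \<open>w\<close>, which is normal to \<open>M\<close>.
  It is a local diffeomorphism, with inverse \<open>Z\<close>, and \<open>g y\<close> is the normal part of \<open>y\<close>.

  For \<open>y\<close> near \<open>x0\<close>, take a nearest point \<open>m\<close> of \<open>M\<close>, with coordinate \<open>u = \<phi> m\<close>. The vector \<open>y - m\<close> is
  normal to \<open>M\<close>, so it comes from \<open>w\<close> obtained by applying the transposed derivative of \<open>\<psi>\<close> to it, and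
  \<open>E (u + w) = y\<close>. As \<open>u + w\<close> depends continuously on \<open>(y, m)\<close>, it lies in the domain where \<open>E\<close>
  is injective, so it equals \<open>Z y\<close> and \<open>g y = y - m\<close>.

  On \<open>M\<close> the map \<open>g\<close> vanishes, so its derivative kills tangent vectors. Conversely, a vector killed
  by the derivative of \<open>y \<mapsto> y - \<psi> (p (Z y))\<close> is the image under the derivative of \<open>\<psi>\<close> of a vector
  of \<open>L\<close>, hence the velocity of the image of a line in \<open>L\<close>.\<close>

theorem distance_is_norm_of_smooth_map:
  fixes X M :: "(real^'n) set"
  assumes X: "open X" and M: "closed_submanifold X M" and x0: "x0 \<in> M"
  obtains W and g :: "real^'n \<Rightarrow> real^'n" where "open W" "x0 \<in> W" "smooth_on g W"
    "\<And>y. y \<in> W \<Longrightarrow> infdist y M = norm (g y)"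
    "tangent_space M x0 = {v. frechet_derivative g (at x0) v = 0}"
proof -
  obtain U V \<phi> \<psi> and L :: "(real^'n) set" where U: "open U" "x0 \<in> U" and V: "open V"
    and hom: "homeomorphism U V \<phi> \<psi>" and sm: "smooth_on \<phi> U" "smooth_on \<psi> V"
    and L: "subspace L" "\<phi> ` (M \<inter> U) = L \<inter> V"
    using bspec[OF conjunct2[OF M[unfolded closed_submanifold_def]] x0] by (elim exE conjE) (rule that)
  have \<psi>\<phi>: "\<psi> (\<phi> x) = x" if "x \<in> U" for x using hom that homeomorphism_apply1 by blast
  have \<phi>\<psi>: "\<phi> (\<psi> z) = z" if "z \<in> V" for z using hom that homeomorphism_apply2 by blast
  have \<phi>U: "\<phi> ` U = V" and \<psi>V: "\<psi> ` V = U" using homeomorphism_image1[OF hom] homeomorphism_image2[OF hom] .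
  have \<psi>M: "\<psi> z \<in> M" if "z \<in> L" "z \<in> V" for z
    using that L(2) \<psi>\<phi> by (metis (no_types, lifting) IntD1 IntD2 IntI imageE)
  define D\<phi> where "D\<phi> x = frechet_derivative \<phi> (at x)" for x
  define D\<psi> where "D\<psi> z = frechet_derivative \<psi> (at z)" for z
  have d\<phi>: "(\<phi> has_derivative D\<phi> x) (at x)" if "x \<in> U" for x
    unfolding D\<phi>_def using smooth_on_has_derivative[OF sm(1) that] .
  have d\<psi>: "(\<psi> has_derivative D\<psi> z) (at z)" if "z \<in> V" for z
    unfolding D\<psi>_def using smooth_on_has_derivative[OF sm(2) that] .
  note bl\<phi> = has_derivative_bounded_linear[OF d\<phi>] and bl\<psi> = has_derivative_bounded_linear[OF d\<psi>]
  have D\<phi>\<psi>: "D\<phi> (\<psi> z) (D\<psi> z v) = v" if "z \<in> V" for z v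
    using derivative_left_inverse[OF V that d\<psi>[OF that] d\<phi> \<phi>\<psi>] \<psi>V that by blast
  have D\<psi>\<phi>: "D\<psi> (\<phi> x) (D\<phi> x v) = v" if "x \<in> U" for x v
    using derivative_left_inverse[OF U(1) that d\<phi>[OF that] d\<psi> \<psi>\<phi>] \<phi>U that by blast
  obtain p where p: "linear p" "\<And>z. p z \<in> L" "\<And>z l. l \<in> L \<Longrightarrow> (z - p z) \<bullet> l = 0"
    "\<And>z. z \<in> L \<Longrightarrow> p z = z" "\<And>z. (\<And>l. l \<in> L \<Longrightarrow> z \<bullet> l = 0) \<Longrightarrow> p z = 0"
    using orthogonal_projection_exists[OF L(1)] by metis
  have blp: "bounded_linear p" using p(1) by (simp add: linear_conv_bounded_linear)
  have contp: "continuous_on S p" for S using blp by (rule linear_continuous_on)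
  define z0 where "z0 = \<phi> x0"
  have z0: "z0 \<in> L" "z0 \<in> V" "\<psi> z0 = x0"
    using L(2) U x0 \<psi>\<phi> unfolding z0_def by blast+
  have pz0: "p z0 = z0" using p(4) z0(1) .

  define E where "E z = \<psi> (p z) + (\<Sum>b\<in>Basis. ((z - p z) \<bullet> D\<phi> (\<psi> (p z)) b) *\<^sub>R b)" for z
  define V' where "V' = p -` V"
  have V': "open V'" "z0 \<in> V'"
    unfolding V'_def using contp V z0 pz0 by (auto intro: open_vimage)
  have pV': "p ` V' \<subseteq> V" by (auto simp: V'_def)
  have smp: "smooth_on p S" if "open S" for S using smooth_on_bounded_linear[OF blp that] .
  have sm\<psi>p: "smooth_on (\<lambda>z. \<psi> (p z)) V'"
    using smooth_on_compose[OF V'(1) V smp[OF V'(1)] sm(2) pV'] .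
  have smc: "smooth_on (\<lambda>z. D\<phi> (\<psi> (p z)) b) V'" for b
    using smooth_on_compose[OF V'(1) U(1) sm\<psi>p smooth_on_frechet_derivative[OF sm(1), of b]] pV' \<psi>V
    unfolding D\<phi>_def by blast
  have sm_id: "smooth_on (\<lambda>z. z) S" if "open S" for S :: "(real^'n) set"
    using smooth_on_bounded_linear[OF bounded_linear_ident that] .
  have smE: "smooth_on E V'"
    unfolding E_def
    by (intro smooth_on_add smooth_on_sum smooth_on_bilinear[OF bounded_bilinear_scaleR]
        smooth_on_bilinear[OF bounded_bilinear_inner] smooth_on_diff smooth_on_const
        V' sm\<psi>p smc smp sm_id)
  define E' where "E' h = D\<psi> z0 (p h) + (\<Sum>b\<in>Basis. ((h - p h) \<bullet> D\<phi> x0 b) *\<^sub>R b)" for h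
  have dp: "(p has_derivative p) (at z0)" using bounded_linear_imp_has_derivative[OF blp] .
  have "(E has_derivative E') (at z0)"
  proof -
    have "((\<lambda>z. \<psi> (p z)) has_derivative (\<lambda>h. D\<psi> z0 (p h))) (at z0)"
      using has_derivative_compose[OF dp] d\<psi>[OF z0(2)] pz0 by simp
    \<comment> \<open>the derivative of the coefficients \<open>D\<phi>\<close> does not enter, because \<open>z0 - p z0 = 0\<close>\<close>
    moreover have "((\<lambda>z. ((z - p z) \<bullet> D\<phi> (\<psi> (p z)) b) *\<^sub>R b) has_derivative
        (\<lambda>h. ((h - p h) \<bullet> D\<phi> x0 b) *\<^sub>R b)) (at z0)" for b
    proof -
      have "((\<lambda>z. (z - p z) \<bullet> D\<phi> (\<psi> (p z)) b) has_derivative (\<lambda>h. (h - p h) \<bullet> D\<phi> x0 b)) (at z0)"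
        using has_derivative_inner[OF has_derivative_diff[OF has_derivative_ident dp]
            smooth_on_has_derivative[OF smc V'(2), of b]] pz0 z0(3) by simp
      then show ?thesis by (rule has_derivative_scaleR_left)
    qed
    ultimately show ?thesis
      unfolding E_def E'_def by (intro has_derivative_add has_derivative_sum)
  qed
  then have E'_eq: "frechet_derivative E (at z0) = E'" and linE': "linear E'"
    using frechet_derivative_at has_derivative_linear by metis+
  have inner_E': "E' h \<bullet> v = D\<psi> z0 (p h) \<bullet> v + (h - p h) \<bullet> D\<phi> x0 v" for h v
    unfolding E'_def inner_add_left inner_transpose[OF bl\<phi>[OF U(2)]] ..
  \<comment> \<open>the tangential and the normal part of \<open>E' h\<close> are orthogonal, so both vanish\<close>
  have "h = 0" if "E' h = 0" for h
  proof -
    have inv: "D\<phi> x0 (D\<psi> z0 v) = v" for v using D\<phi>\<psi>[OF z0(2)] z0(3) by simp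
    have "D\<psi> z0 (p h) \<bullet> D\<psi> z0 (p h) = 0"
      using inner_E'[of h "D\<psi> z0 (p h)"] that p(2,3) by (simp add: inv)
    then have "D\<psi> z0 (p h) = 0" by simp
    then have "p h = 0" using inv[of "p h"] inv[of 0] linear_0[OF has_derivative_linear[OF d\<psi>[OF z0(2)]]]
      by simp
    then show "h = 0"
      using inner_E'[of h "D\<psi> z0 h"] that \<open>D\<psi> z0 (p h) = 0\<close> by (simp add: inv)
  qed
  then have "inj (frechet_derivative E (at z0))"
    unfolding E'_eq using linear_injective_0[OF linE'] by blast
  then obtain U1 V1 Z where U1: "open U1" "z0 \<in> U1" "U1 \<subseteq> V'" and V1: "open V1"
    and homZ: "homeomorphism U1 V1 E Z" and smZ: "smooth_on Z V1"
    using smooth_local_inverse[OF V' smE] by metis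
  have ZE: "Z (E z) = z" if "z \<in> U1" for z using homZ that homeomorphism_apply1 by blast
  have EU1: "E ` U1 = V1" and ZV1: "Z ` V1 = U1" using homeomorphism_image1[OF homZ] homeomorphism_image2[OF homZ] .
  have Ez0: "E z0 = x0" unfolding E_def pz0 using z0(3) by simp
  have x0V1: "x0 \<in> V1" using EU1 U1(2) Ez0 by blast
  have Zx0: "Z x0 = z0" using ZE[OF U1(2)] Ez0 by simp

  define g where "g y = y - \<psi> (p (Z y))" for y
  have smg: "smooth_on g V1"
    unfolding g_def using smooth_on_compose[OF V1 V'(1) smZ sm\<psi>p] ZV1 U1(3)
    by (intro smooth_on_diff V1 sm_id) simp

  \<comment> \<open>the vector \<open>u + w\<close> belonging to \<open>y\<close> and a nearest point \<open>m\<close>\<close>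
  define \<Phi> where "\<Phi> = (\<lambda>(y, m). \<phi> m + (\<Sum>b\<in>Basis. ((y - m) \<bullet> D\<psi> (\<phi> m) b) *\<^sub>R b))"
  have cont\<phi>: "continuous_on U \<phi>" using homeomorphism_cont1[OF hom] .
  have contD: "continuous_on U (\<lambda>m. D\<psi> (\<phi> m) b)" for b
    unfolding D\<psi>_def using continuous_on_compose2[OF
        smooth_on_imp_continuous_on[OF smooth_on_frechet_derivative[OF sm(2), of b]] cont\<phi>] \<phi>U by simp
  have cont\<Phi>: "continuous_on (UNIV \<times> U) \<Phi>"
    unfolding \<Phi>_def case_prod_unfold
    by (intro continuous_intros continuous_on_compose2[OF cont\<phi>] continuous_on_compose2[OF contD]) auto
  have "open ((UNIV \<times> U) \<inter> \<Phi> -` U1)"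
    using continuous_open_preimage[OF cont\<Phi> open_Times[OF open_UNIV U(1)] U1(1)] .
  moreover have "(x0, x0) \<in> (UNIV \<times> U) \<inter> \<Phi> -` U1"
    using U(2) U1(2) unfolding \<Phi>_def z0_def by simp
  ultimately obtain A B where AB: "open A" "open B" "x0 \<in> A" "x0 \<in> B"
    "A \<times> B \<subseteq> (UNIV \<times> U) \<inter> \<Phi> -` U1"
    by (rule open_prod_elim) auto
  obtain r where r: "r > 0" "ball x0 r \<subseteq> B" using AB openE by blast
  have Mcl: "closedin (top_of_set X) M" using M unfolding closed_submanifold_def by blast
  obtain R where R: "R > 0"
    "\<And>y. dist y x0 < R \<Longrightarrow> \<exists>m\<in>M. infdist y M = dist y m \<and> dist m x0 \<le> 2 * dist y x0"
    using nearest_point_locally[OF X Mcl x0] by metis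
  \<comment> \<open>radius \<open>r / 2\<close>: a nearest point is at most twice as far from \<open>x0\<close> as \<open>y\<close> is\<close>
  define W where "W = V1 \<inter> A \<inter> ball x0 (min R (r / 2))"
  have W: "open W" "x0 \<in> W" "W \<subseteq> V1"
    unfolding W_def using V1 AB x0V1 r R by auto
  have dist_eq: "infdist y M = norm (g y)" if y: "y \<in> W" for y
  proof -
    obtain m where m: "m \<in> M" "infdist y M = dist y m" "dist m x0 \<le> 2 * dist y x0"
      using R(2)[of y] y unfolding W_def by (auto simp: dist_commute)
    have "m \<in> B" using m(3) y r unfolding W_def by (auto simp: dist_commute subset_iff)
    then have mU: "m \<in> U" and \<Phi>U1: "\<Phi> (y, m) \<in> U1" using y AB(5) unfolding W_def by auto
    define u where "u = \<phi> m"
    have u: "u \<in> L" "u \<in> V" "\<psi> u = m" using m(1) mU L(2) \<psi>\<phi> unfolding u_def by blast+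
    define w where "w = (\<Sum>b\<in>Basis. ((y - m) \<bullet> D\<psi> u b) *\<^sub>R b)"
    have w: "w \<bullet> v = (y - m) \<bullet> D\<psi> u v" for v
      unfolding w_def by (rule inner_transpose[OF bl\<psi>[OF u(2)]])
    have "w \<bullet> l = 0" if l: "l \<in> L" for l
    proof -
      have "dist y (\<psi> u) \<le> dist y (\<psi> (u + t *\<^sub>R l))" if "u + t *\<^sub>R l \<in> V" for t
      proof -
        have "u + t *\<^sub>R l \<in> L" using u(1) l L(1) by (simp add: subspace_add subspace_scale)
        then show ?thesis using infdist_le[OF \<psi>M[OF _ that]] m(2) u(3) by metis
      qed
      then show ?thesis
        using nearest_point_critical[OF V u(2) d\<psi>[OF u(2)], of l y] w u(3) by simp
    qed
    then have "p w = 0" using p(5) by blast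
    then have pz: "p (u + w) = u" using p(4)[OF u(1)] by (simp add: linear_add[OF p(1)])
    have z: "u + w \<in> U1" using \<Phi>U1 unfolding \<Phi>_def u_def w_def by simp
    have "(\<Sum>b\<in>Basis. (w \<bullet> D\<phi> m b) *\<^sub>R b) \<bullet> v = (y - m) \<bullet> v" for v
      using inner_transpose[OF bl\<phi>[OF mU], of w v] w[of "D\<phi> m v"] D\<psi>\<phi>[OF mU, of v]
      by (simp add: u_def)
    then have "(\<Sum>b\<in>Basis. (w \<bullet> D\<phi> m b) *\<^sub>R b) = y - m" using vector_eq_rdot by blast
    then have "E (u + w) = y" unfolding E_def pz u(3) by simp
    then have "g y = y - m" using ZE[OF z] pz u(3) unfolding g_def by simp
    then show ?thesis using m(2) by (simp add: dist_norm)
  qed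

  define Dg where "Dg = frechet_derivative g (at x0)"
  have dg: "(g has_derivative Dg) (at x0)"
    unfolding Dg_def using smooth_on_has_derivative[OF smg x0V1] .
  have "tangent_space M x0 = {v. Dg v = 0}"
  proof (intro equalityI subsetI)
    fix v assume "v \<in> tangent_space M x0"
    then obtain \<gamma> e where e: "e > 0" and \<gamma>: "smooth_on \<gamma> {-e<..<e}" "\<gamma> ` {-e<..<e} \<subseteq> M" "\<gamma> 0 = x0"
      "(\<gamma> has_vector_derivative v) (at (0::real))"
      unfolding tangent_space_def by blast
    define S where "S = {-e<..<e} \<inter> \<gamma> -` W"
    have S: "open S" "0 \<in> S"
      unfolding S_def using continuous_open_preimage[OF smooth_on_imp_continuous_on[OF \<gamma>(1)] _ W(1)]
        e W(2) \<gamma>(3) by auto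
    have "g (\<gamma> t) = 0" if "t \<in> S" for t
    proof -
      have "\<gamma> t \<in> M" "\<gamma> t \<in> W" using that \<gamma>(2) unfolding S_def by auto
      then show ?thesis using dist_eq[of "\<gamma> t"] by simp
    qed
    moreover have "((\<lambda>t. g (\<gamma> t)) has_derivative (\<lambda>h. Dg (h *\<^sub>R v))) (at 0)"
      using has_derivative_compose[OF \<gamma>(4)[unfolded has_vector_derivative_def]] dg \<gamma>(3) by simp
    ultimately have "((\<lambda>t. 0) has_derivative (\<lambda>h. Dg (h *\<^sub>R v))) (at (0::real))"
      using has_derivative_transform_within_open[OF _ S, of "\<lambda>t. g (\<gamma> t)" _ UNIV "\<lambda>t. 0"] by simp
    then have "(\<lambda>h::real. Dg (h *\<^sub>R v)) = (\<lambda>h. 0)"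
      using has_derivative_unique has_derivative_const by blast
    from fun_cong[OF this, of 1] show "v \<in> {v. Dg v = 0}" by simp
  next
    fix v assume "v \<in> {v. Dg v = 0}"
    then have v0: "Dg v = 0" by simp
    define DZ where "DZ = frechet_derivative Z (at x0)"
    have dZ: "(Z has_derivative DZ) (at x0)"
      unfolding DZ_def using smooth_on_has_derivative[OF smZ x0V1] .
    have "(p has_derivative p) (at (Z x0))" using bounded_linear_imp_has_derivative[OF blp] .
    from has_derivative_compose[OF has_derivative_compose[OF dZ this]]
    have "(g has_derivative (\<lambda>h. h - D\<psi> z0 (p (DZ h)))) (at x0)"
      unfolding g_def using d\<psi>[OF z0(2)] Zx0 pz0
      by (intro has_derivative_diff has_derivative_ident) simp
    then have "Dg = (\<lambda>h. h - D\<psi> z0 (p (DZ h)))" using dg has_derivative_unique by blast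
    then have v: "v = D\<psi> z0 (p (DZ v))" using v0 by simp
    define l where "l = p (DZ v)"
    have l: "l \<in> L" using p(2) by (simp add: l_def)
    define S where "S = (\<lambda>t::real. z0 + t *\<^sub>R l) -` V"
    have "open S" "0 \<in> S"
      unfolding S_def using z0(2) by (auto intro!: open_vimage V continuous_intros)
    then obtain e where e: "e > 0" "ball 0 e \<subseteq> S" using openE by blast
    have eS: "{-e<..<e} \<subseteq> S" using e(2) by (auto simp: subset_iff dist_real_def)
    define \<gamma> where "\<gamma> t = \<psi> (z0 + t *\<^sub>R l)" for t :: real
    have "smooth_on (\<lambda>t. z0 + t *\<^sub>R l) {-e<..<e}"
      by (intro smooth_on_add smooth_on_const smooth_on_bounded_linear bounded_linear_scaleR_left) auto
    then have "smooth_on \<gamma> {-e<..<e}"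
      unfolding \<gamma>_def using eS
      by (intro smooth_on_compose[OF _ V _ sm(2)]) (auto simp: S_def)
    moreover have "\<gamma> ` {-e<..<e} \<subseteq> M"
      using \<psi>M eS z0(1) l L(1) unfolding \<gamma>_def S_def
      by (auto simp: subset_iff subspace_add subspace_scale)
    moreover have "\<gamma> 0 = x0" using z0(3) by (simp add: \<gamma>_def)
    moreover have "(\<gamma> has_vector_derivative v) (at 0)"
    proof -
      have d: "((\<lambda>t::real. z0 + t *\<^sub>R l) has_derivative (\<lambda>h. h *\<^sub>R l)) (at 0)"
        by (auto intro!: derivative_eq_intros)
      have "(\<gamma> has_derivative (\<lambda>h. D\<psi> z0 (h *\<^sub>R l))) (at 0)"
        unfolding \<gamma>_def using has_derivative_compose[OF d] d\<psi>[OF z0(2)] by simp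
      then show ?thesis
        unfolding has_vector_derivative_def
        using v has_derivative_linear[OF d\<psi>[OF z0(2)]] by (simp add: l_def linear_cmul)
    qed
    ultimately show "v \<in> tangent_space M x0"
      unfolding tangent_space_def using e(1) by blast
  qed
  then show thesis
    using that[OF W(1,2) smooth_on_subset[OF smg W(3)] dist_eq] unfolding Dg_def by blast
qed

text \<open>The first derivative of \<open>g \<bullet> g\<close> along \<open>v\<close> is \<open>2 g \<bullet> D\<^sub>v g\<close>. Differentiating again at a zero of
  \<open>g\<close>, only the term that differentiates the factor \<open>g\<close> survives.\<close>

lemma hessian_norm_square:
  fixes g :: "real^'n \<Rightarrow> real^'n"
  assumes W: "open W" "x \<in> W" and g: "smooth_on g W" "g x = 0"
    and f: "\<And>y. y \<in> W \<Longrightarrow> f y = (norm (g y))\<^sup>2"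
  defines "G \<equiv> matrix (frechet_derivative g (at x))"
  shows "smooth_on f W" "hessian f x = 2 *\<^sub>R (transpose G ** G)"
proof -
  define D where "D y = frechet_derivative g (at y)" for y
  have dg: "(g has_derivative D y) (at y)" if "y \<in> W" for y
    unfolding D_def using smooth_on_has_derivative[OF g(1) that] .
  have smD: "smooth_on (\<lambda>y. D y v) W" for v
    unfolding D_def using smooth_on_frechet_derivative[OF g(1)] .
  have f_inner: "f y = g y \<bullet> g y" if "y \<in> W" for y
    using f[OF that] by (simp add: power2_norm_eq_inner)
  have "smooth_on (\<lambda>y. g y \<bullet> g y) W"
    by (intro smooth_on_bilinear[OF bounded_bilinear_inner] W g)
  then show "smooth_on f W" using smooth_on_cong[OF W(1), of f] f_inner by simp
  have df: "frechet_derivative f (at y) v = 2 * (g y \<bullet> D y v)" if y: "y \<in> W" for y v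
  proof -
    have "((\<lambda>y. g y \<bullet> g y) has_derivative (\<lambda>h. g y \<bullet> D y h + D y h \<bullet> g y)) (at y)"
      using has_derivative_inner[OF dg[OF y] dg[OF y]] .
    then have "(f has_derivative (\<lambda>h. g y \<bullet> D y h + D y h \<bullet> g y)) (at y)"
      by (rule has_derivative_transform_within_open[OF _ W(1) y]) (simp add: f_inner)
    from frechet_derivative_at[OF this, symmetric] show ?thesis by (simp add: inner_commute)
  qed
  have ddf: "frechet_derivative (\<lambda>y. frechet_derivative f (at y) v) (at x) w = 2 * (D x w \<bullet> D x v)"
    for v w
  proof -
    have "((\<lambda>y. 2 * (g y \<bullet> D y v)) has_derivative (\<lambda>h. 2 * (D x h \<bullet> D x v))) (at x)"
      using has_derivative_mult_right[OF has_derivative_inner[OF dg[OF W(2)]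
            smooth_on_has_derivative[OF smD W(2)]], of 2 v] g(2) by simp
    then have "((\<lambda>y. frechet_derivative f (at y) v) has_derivative (\<lambda>h. 2 * (D x h \<bullet> D x v))) (at x)"
      by (rule has_derivative_transform_within_open[OF _ W]) (simp add: df)
    from frechet_derivative_at[OF this, symmetric] show ?thesis by simp
  qed
  show "hessian f x = 2 *\<^sub>R (transpose G ** G)"
    unfolding hessian_def ddf
    by (simp add: vec_eq_iff G_def D_def matrix_matrix_mult_def transpose_def matrix_def inner_vec_def)
qed


section \<open>Freeness and strict plurisubharmonicity\<close>

lemma free_iff_strictly_psh_at:
  fixes P :: "(real^'n^'n) set" and X M :: "(real^'n) set"
  assumes P: "P \<subseteq> Sym2" "closed P" "convex_cone P" "positivity_condition P"
    and X: "open X" "closed_submanifold X M" and x: "x \<in> M"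
  shows "free_subspace P (tangent_space M x) \<longleftrightarrow> strictly_psh_at P (\<lambda>y. (infdist y M)\<^sup>2) x"
proof -
  obtain W and g :: "real^'n \<Rightarrow> real^'n" where W: "open W" "x \<in> W" and g: "smooth_on g W"
    and dist: "\<And>y. y \<in> W \<Longrightarrow> infdist y M = norm (g y)"
    and T: "tangent_space M x = {v. frechet_derivative g (at x) v = 0}"
    using distance_is_norm_of_smooth_map[OF X x] by metis
  define G where "G = matrix (frechet_derivative g (at x))"
  have "linear (frechet_derivative g (at x))"
    using has_derivative_linear[OF smooth_on_has_derivative[OF g W(2)]] .
  then have "G *v v = frechet_derivative g (at x) v" for v
    unfolding G_def using matrix_vector_mul(2) by metis
  then have T': "tangent_space M x = {v. G *v v = 0}" using T by simp
  have "g x = 0" using dist[OF W(2)] x by simp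
  note hess = hessian_norm_square[OF W g this, of "\<lambda>y. (infdist y M)\<^sup>2", folded G_def]
  have "smooth_near (\<lambda>y. (infdist y M)\<^sup>2) x"
    unfolding smooth_near_def using W hess(1) dist by auto
  then show ?thesis
    unfolding strictly_psh_at_def using hess(2) dist free_iff_gram_interior[OF P T', of 2] by simp
qed

theorem theorem11p2:
  fixes P :: "(real^'n^'n) set" and X M :: "(real^'n) set"
  assumes "P \<subseteq> Sym2" and "closed P" and "convex_cone P" and "positivity_condition P"
    and "open X" and "closed_submanifold X M"
  shows "(free_submanifold P M \<longleftrightarrow> (\<forall>x\<in>M. strictly_psh_at P (\<lambda>y. (infdist y M)\<^sup>2) x)) \<and>
         ((\<forall>x\<in>M. strictly_psh_at P (\<lambda>y. (infdist y M)\<^sup>2) x) \<longrightarrow>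
            (\<exists>U. open U \<and> M \<subseteq> U \<and> U \<subseteq> X \<and>
                 (\<forall>x\<in>U. strictly_psh_at P (\<lambda>y. (infdist y M)\<^sup>2) x)))"
proof (intro conjI impI)
  show "free_submanifold P M \<longleftrightarrow> (\<forall>x\<in>M. strictly_psh_at P (\<lambda>y. (infdist y M)\<^sup>2) x)"
    unfolding free_submanifold_def using free_iff_strictly_psh_at[OF assms] by blast
next
  assume psh: "\<forall>x\<in>M. strictly_psh_at P (\<lambda>y. (infdist y M)\<^sup>2) x"
  let ?N = "{x. strictly_psh_at P (\<lambda>y. (infdist y M)\<^sup>2) x}"
  have "open ?N"
    unfolding open_subopen[of ?N] using strictly_psh_at_open_nhd by (metis mem_Collect_eq subsetI)
  moreover have "M \<subseteq> X"
    using assms(6) closedin_subset unfolding closed_submanifold_def by fastforce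
  ultimately show "\<exists>U. open U \<and> M \<subseteq> U \<and> U \<subseteq> X \<and>
      (\<forall>x\<in>U. strictly_psh_at P (\<lambda>y. (infdist y M)\<^sup>2) x)"
    using psh assms(5) by (intro exI[of _ "?N \<inter> X"]) auto
qed

end
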